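(* Every finitely generated commutative monoid is surjunctive.
   Context: Let $M$ be a monoid and $A$ a set. The set $A^M$ of all maps $x\colon M\to A$ carries the shift action of $M$ given by $(mx)(m') := x(m'm)$ for $m,m'\in M$, and the prodiscrete uniform structure, for which a base of entourages is given by the sets $W_F := \{(x,y)\in A^M\times A^M : x|_F = y|_F\}$, $F$ running over all finite subsets of $M$. A cellular automaton over $M$ with alphabet $A$ is a map $\tau\colon A^M\to A^M$ that is $M$-equivariant ($\tau(mx)=m\tau(x)$ for all $m\in M$, $x\in A^M$) and uniformly continuous. The monoid $M$ is called surjunctive if, for every finite set $A$, every injective cellular automaton $\tau\colon A^M\to A^M$ is surjective. *)

theory Defs
  imports "HOL-Algebra.Group" HOL.Hull
begin

text \<open>
  Monoids are the carrier-based ones of HOL-Algebra. The set of maps from \<open>M\<close> to \<open>A\<close> is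
  rendered by the extensional functions, so that equality of configurations is equality of HOL
  functions.
\<close>

definition configs :: "('a, 'c) monoid_scheme \<Rightarrow> 'b set \<Rightarrow> ('a \<Rightarrow> 'b) set" where
  "configs M A = carrier M \<rightarrow>\<^sub>E A"

definition shift :: "('a, 'c) monoid_scheme \<Rightarrow> 'a \<Rightarrow> ('a \<Rightarrow> 'b) \<Rightarrow> 'a \<Rightarrow> 'b" where
  "shift M m x = (\<lambda>m'\<in>carrier M. x (m' \<otimes>\<^bsub>M\<^esub> m))"

definition agree_entourage ::
  "('a, 'c) monoid_scheme \<Rightarrow> 'b set \<Rightarrow> 'a set \<Rightarrow> (('a \<Rightarrow> 'b) \<times> ('a \<Rightarrow> 'b)) set" where
  "agree_entourage M A F =
     {(x, y) \<in> configs M A \<times> configs M A. restrict x F = restrict y F}"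

text \<open>
  As in the class \<open>uniform_space\<close>, a uniform structure is given by its filter of entourages. The
  class itself is not usable here, since the underlying set is not a whole type.
\<close>

definition prodiscrete_uniformity ::
  "('a, 'c) monoid_scheme \<Rightarrow> 'b set \<Rightarrow> (('a \<Rightarrow> 'b) \<times> ('a \<Rightarrow> 'b)) filter" where
  "prodiscrete_uniformity M A =
     (INF F \<in> {F. finite F \<and> F \<subseteq> carrier M}. principal (agree_entourage M A F))"

lemma eventually_prodiscrete_uniformity:
  "eventually P (prodiscrete_uniformity M A) \<longleftrightarrow>
     (\<exists>F. finite F \<and> F \<subseteq> carrier M \<and> (\<forall>p \<in> agree_entourage M A F. P p))"
proof -
  have "eventually P (prodiscrete_uniformity M A) \<longleftrightarrow>
     (\<exists>F\<in>{F. finite F \<and> F \<subseteq> carrier M}. eventually P (principal (agree_entourage M A F)))"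
    unfolding prodiscrete_uniformity_def
  proof (rule eventually_INF_base)
    show "{F. finite F \<and> F \<subseteq> carrier M} \<noteq> {}"
      by blast
  next
    fix F G
    assume "F \<in> {F. finite F \<and> F \<subseteq> carrier M}" "G \<in> {F. finite F \<and> F \<subseteq> carrier M}"
    moreover have "agree_entourage M A (F \<union> G) \<subseteq> agree_entourage M A F \<inter> agree_entourage M A G"
      by (auto simp: agree_entourage_def restrict_def fun_eq_iff)
    ultimately show "\<exists>H\<in>{F. finite F \<and> F \<subseteq> carrier M}. principal (agree_entourage M A H) \<le>
        inf (principal (agree_entourage M A F)) (principal (agree_entourage M A G))"
      by (intro bexI[of _ "F \<union> G"]) auto
  qed
  then show ?thesis
    by (auto simp: eventually_principal)
qed

definition cellular_automaton ::
  "('a, 'c) monoid_scheme \<Rightarrow> 'b set \<Rightarrow> (('a \<Rightarrow> 'b) \<Rightarrow> 'a \<Rightarrow> 'b) \<Rightarrow> bool" where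
  "cellular_automaton M A \<tau> \<longleftrightarrow>
     \<tau> \<in> configs M A \<rightarrow> configs M A \<and>
     (\<forall>m\<in>carrier M. \<forall>x\<in>configs M A. \<tau> (shift M m x) = shift M m (\<tau> x)) \<and>
     filterlim (\<lambda>(x, y). (\<tau> x, \<tau> y)) (prodiscrete_uniformity M A) (prodiscrete_uniformity M A)"

text \<open>
  A HOL formula cannot quantify over types, so the type in which the alphabets live is a parameter;
  a statement about \<open>surjunctive TYPE('b) M\<close> with \<open>'b\<close> free covers all finite alphabets.
\<close>

definition surjunctive :: "'b itself \<Rightarrow> ('a, 'c) monoid_scheme \<Rightarrow> bool" where
  "surjunctive _ M \<longleftrightarrow>
     (\<forall>(A :: 'b set) \<tau>. finite A \<longrightarrow> cellular_automaton M A \<tau> \<longrightarrow>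
        inj_on \<tau> (configs M A) \<longrightarrow> \<tau> ` configs M A = configs M A)"

definition finitely_generated_monoid :: "('a, 'c) monoid_scheme \<Rightarrow> bool" where
  "finitely_generated_monoid M \<longleftrightarrow>
     (\<exists>S. finite S \<and> S \<subseteq> carrier M \<and> (\<lambda>H. submonoid H M) hull S = carrier M)"

end

theory Submission
  imports Defs "HOL-Algebra.FiniteProduct" "HOL-Library.Multiset_Order" "HOL-Analysis.Function_Topology"
begin

text \<open>
  A finitely generated commutative monoid is residually finite. Indeed, let \<open>R\<close> be a congruence
  that is maximal among those separating \<open>a\<close> from \<open>b\<close>. Ascending chains of congruences stabilise, so
  a power \<open>d\<close> of any element \<open>c\<close> has the same kernel modulo \<open>R\<close> as \<open>d\<^sup>2\<close>. If this kernel is \<open>R\<close>,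
  then \<open>c\<close> is cancellable, and maximality gives it finite order; otherwise maximality makes \<open>d\<close> a
  zero. Either way the powers of \<open>c\<close> fall into finitely many classes, hence so do the monomials in
  the generators.

  By equivariance, a cellular automaton \<open>\<tau>\<close> preserves the configurations that are constant on the
  classes of a given congruence. If the index is finite, there are finitely many of them, and an
  injective \<open>\<tau>\<close> permutes them. By residual finiteness, every configuration agrees with one of these
  on any given finite set, so the image of \<open>\<tau>\<close> is dense; it is closed by compactness.
\<close>

section \<open>Dickson's lemma and chains of congruences on multisets\<close>

lemma incseq_subseq_wellorder:
  fixes f :: "nat \<Rightarrow> 'a :: wellorder"
  obtains r :: "nat \<Rightarrow> nat" where "strict_mono r" "incseq (\<lambda>n. f (r n))"
proof -
  obtain r where r: "strict_mono r" "monoseq (\<lambda>n. f (r n))"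
    using seq_monosub[of f] by blast
  show thesis
  proof (cases "incseq (\<lambda>n. f (r n))")
    case True
    with r(1) show thesis by (rule that)
  next
    case False
    with r(2) have dec: "decseq (\<lambda>n. f (r n))"
      by (simp add: monoseq_iff)
    \<comment> \<open>A decreasing sequence in a well-order attains its least value and is constant
      from there on, so the tail is increasing as well.\<close>
    obtain N where N: "\<And>n. f (r N) \<le> f (r n)"
      using exists_least_iff[of "\<lambda>v. \<exists>n. v = f (r n)"] by (metis linorder_not_less)
    have "f (r (n + N)) = f (r N)" for n
      using decseqD[OF dec, of N "n + N"] N[of "n + N"] by simp
    moreover have "strict_mono (\<lambda>n. r (n + N))"
      using r(1) by (simp add: strict_mono_def)
    ultimately show thesis
      using that[of "\<lambda>n. r (n + N)"] by (simp add: incseq_def)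
  qed
qed

text \<open>Coordinates are treated one at a time: passing to a further subsequence keeps the
  monotonicity already achieved.\<close>

lemma dickson_subseq:
  fixes f :: "nat \<Rightarrow> 'i \<Rightarrow> 'a :: wellorder"
  assumes "finite I"
  shows "\<exists>r :: nat \<Rightarrow> nat. strict_mono r \<and> (\<forall>i\<in>I. incseq (\<lambda>n. f (r n) i))"
  using assms
proof (induction I)
  case empty
  show ?case using strict_mono_id by auto
next
  case (insert i I)
  then obtain r :: "nat \<Rightarrow> nat" where r: "strict_mono r" "\<forall>i\<in>I. incseq (\<lambda>n. f (r n) i)"
    by blast
  obtain s :: "nat \<Rightarrow> nat" where s: "strict_mono s" "incseq (\<lambda>n. f (r (s n)) i)"
    using incseq_subseq_wellorder[of "\<lambda>n. f (r n) i"] by blast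
  have "incseq (\<lambda>n. f (r (s n)) j)" if "j \<in> I" for j
    using r(2) that s(1) by (simp add: incseq_def strict_mono_less_eq)
  moreover have "strict_mono (\<lambda>n. r (s n))"
    using strict_mono_o[OF r(1) s(1)] by (simp add: o_def)
  ultimately show ?case
    using s(2) by (intro exI[of _ "\<lambda>n. r (s n)"]) simp
qed

text \<open>Multisets play the role of exponent vectors; the coordinates outside the finite set
  \<open>I\<close> all vanish.\<close>

lemma dickson_multiset:
  fixes f :: "nat \<Rightarrow> 'i multiset"
  assumes "finite I" and "\<And>n. set_mset (f n) \<subseteq> I"
  obtains i j where "i < j" "f i \<subseteq># f j"
proof -
  obtain r :: "nat \<Rightarrow> nat" where r: "strict_mono r" "\<forall>i\<in>I. incseq (\<lambda>n. count (f (r n)) i)"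
    using dickson_subseq[OF assms(1), of "\<lambda>n. count (f n)"] by blast
  have "count (f (r 0)) x \<le> count (f (r 1)) x" for x
  proof (cases "x \<in> I")
    case True
    with r(2) show ?thesis by (simp add: incseq_def)
  next
    case False
    with assms(2)[of "r 0"] have "x \<notin># f (r 0)"
      by blast
    then show ?thesis by (simp add: not_in_iff)
  qed
  then have "f (r 0) \<subseteq># f (r 1)"
    by (rule mset_subset_eqI)
  moreover have "r 0 < r 1"
    using r(1) by (simp add: strict_mono_def)
  ultimately show thesis by (rule that[rotated])
qed

text \<open>
  A congruence is determined within any larger one by its set of non-minimal elements (with respect
  to a translation-invariant well-order), and that set is an upset for divisibility. So Dickson's
  lemma yields the stabilisation.
\<close>

lemma multiset_congruence_chain_stabilizes:
  fixes E :: "nat \<Rightarrow> 'i :: wellorder multiset rel" and I :: "'i set"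
  defines "D \<equiv> {X. set_mset X \<subseteq> I}"
  assumes "finite I"
    and eq: "\<And>n. equiv D (E n)"
    and trans_inv: "\<And>n X Y Z. (X, Y) \<in> E n \<Longrightarrow> Z \<in> D \<Longrightarrow> (X + Z, Y + Z) \<in> E n"
    and chain: "\<And>n. E n \<subseteq> E (Suc n)"
  shows "\<exists>n. E (Suc n) = E n"
proof (rule ccontr)
  assume neq: "\<nexists>n. E (Suc n) = E n"
  \<comment> \<open>Here \<open><\<close> is the multiset order: total, well-founded and invariant
    under addition, as the index type is well-ordered.\<close>
  define L where "L n = {X. \<exists>Y<X. (X, Y) \<in> E n}" for n
  have L_mono: "L i \<subseteq> L j" if "i \<le> j" for i j
  proof -
    have "E i \<subseteq> E j"
      using chain that by (rule lift_Suc_mono_le)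
    then show ?thesis unfolding L_def by auto
  qed
  have L_add: "X + Z \<in> L n" if "X \<in> L n" "Z \<in> D" for X Z n
  proof -
    obtain Y where "Y < X" "(X, Y) \<in> E n"
      using \<open>X \<in> L n\<close> unfolding L_def by blast
    then have "Y + Z < X + Z" "(X + Z, Y + Z) \<in> E n"
      using trans_inv \<open>Z \<in> D\<close> by simp_all
    then show ?thesis unfolding L_def by blast
  qed
  have min_rep: "\<exists>X'. (X, X') \<in> E n \<and> X' \<notin> L n" if "X \<in> D" for X n
  proof -
    have "(X, X) \<in> E n"
      using eq[of n] that by (simp add: equiv_def refl_on_def)
    then obtain X' where X': "(X, X') \<in> E n" "\<And>Y. Y < X' \<Longrightarrow> (X, Y) \<notin> E n"
      using exists_least_iff[of "\<lambda>Y. (X, Y) \<in> E n"] by metis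
    then have "X' \<notin> L n"
      using eq[of n] unfolding L_def by (auto simp: equiv_def dest: transD)
    with X'(1) show ?thesis by blast
  qed
  have "\<exists>X. X \<in> L (Suc n) - L n \<and> X \<in> D" for n
  proof (rule ccontr)
    assume no: "\<nexists>X. X \<in> L (Suc n) - L n \<and> X \<in> D"
    have sym: "(Y, X) \<in> E m" if "(X, Y) \<in> E m" for X Y m
      using eq[of m] that by (auto simp: equiv_def dest: symD)
    have trans: "(X, Z) \<in> E m" if "(X, Y) \<in> E m" "(Y, Z) \<in> E m" for X Y Z m
      using eq[of m] that by (auto simp: equiv_def dest: transD)
    have dom: "X \<in> D" "Y \<in> D" if "(X, Y) \<in> E m" for X Y m
      using eq[of m] that by (auto simp: equiv_def)
    \<comment> \<open>Replace both elements by the least members of their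
      \<open>E n\<close>-classes. By \<open>no\<close> these stay least in their
      \<open>E (Suc n)\<close>-classes, where they are related, and so they coincide.\<close>
    have "(X, Y) \<in> E n" if XY: "(X, Y) \<in> E (Suc n)" for X Y
    proof -
      obtain X' Y' where X': "(X, X') \<in> E n" "X' \<notin> L n" and Y': "(Y, Y') \<in> E n" "Y' \<notin> L n"
        using min_rep dom[OF XY] by meson
      then have "X' \<notin> L (Suc n)" "Y' \<notin> L (Suc n)"
        using no dom by blast+
      moreover have "(X', Y') \<in> E (Suc n)"
        using X'(1) Y'(1) XY chain[of n] sym trans by (meson subsetD)
      ultimately have "X' = Y'"
        using sym unfolding L_def by (metis (mono_tags, lifting) mem_Collect_eq linorder_neqE)
      then show ?thesis
        using X'(1) Y'(1) sym trans by blast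
    qed
    then have "E (Suc n) = E n"
      using chain[of n] by auto
    with neq show False by blast
  qed
  then obtain X where X: "\<And>n. X n \<in> L (Suc n) - L n" "\<And>n. X n \<in> D"
    by metis
  obtain i j where ij: "i < j" "X i \<subseteq># X j"
    using dickson_multiset[OF assms(2), of X] X(2) unfolding D_def by blast
  \<comment> \<open>\<open>X i\<close> is non-minimal from stage \<open>Suc i\<close> on, hence at
    stage \<open>j\<close>; its multiple \<open>X j\<close> is then non-minimal too, although it was
    chosen outside \<open>L j\<close>.\<close>
  have "X i \<in> L j"
    using L_mono[of "Suc i" j] ij(1) X(1)[of i] by auto
  moreover have "X j - X i \<in> D"
    using X(2)[of j] unfolding D_def by (auto dest: in_diffD)
  ultimately have "X i + (X j - X i) \<in> L j"
    by (rule L_add)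
  then show False
    using X(1)[of j] ij(2) by (simp add: subset_mset.add_diff_inverse)
qed

section \<open>Congruences and maximal separating congruences\<close>

definition monoid_congruence :: "('a, 'c) monoid_scheme \<Rightarrow> 'a rel \<Rightarrow> bool" where
  "monoid_congruence G R \<longleftrightarrow> equiv (carrier G) R \<and>
     (\<forall>x y x' y'. (x, y) \<in> R \<longrightarrow> (x', y') \<in> R \<longrightarrow> (x \<otimes>\<^bsub>G\<^esub> x', y \<otimes>\<^bsub>G\<^esub> y') \<in> R)"

lemma monoid_congruenceD:
  assumes "monoid_congruence G R"
  shows "x \<in> carrier G \<Longrightarrow> (x, x) \<in> R"
    and "(x, y) \<in> R \<Longrightarrow> (y, x) \<in> R"
    and "(x, y) \<in> R \<Longrightarrow> (y, z) \<in> R \<Longrightarrow> (x, z) \<in> R"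
    and "(x, y) \<in> R \<Longrightarrow> x \<in> carrier G"
    and "(x, y) \<in> R \<Longrightarrow> y \<in> carrier G"
    and "(x, y) \<in> R \<Longrightarrow> (x', y') \<in> R \<Longrightarrow> (x \<otimes>\<^bsub>G\<^esub> x', y \<otimes>\<^bsub>G\<^esub> y') \<in> R"
  using assms unfolding monoid_congruence_def
  by (auto simp: equiv_def refl_on_def dest: symD transD)

lemma (in comm_monoid) monoid_congruenceI:
  assumes "equiv (carrier G) R"
    and "\<And>x y z. (x, y) \<in> R \<Longrightarrow> z \<in> carrier G \<Longrightarrow> (z \<otimes> x, z \<otimes> y) \<in> R"
  shows "monoid_congruence G R"
  unfolding monoid_congruence_def
proof (intro conjI allI impI)
  fix x y x' y' assume xy: "(x, y) \<in> R" and xy': "(x', y') \<in> R"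
  have carr: "x \<in> carrier G" "y \<in> carrier G" "x' \<in> carrier G" "y' \<in> carrier G"
    using assms(1) xy xy' by (auto simp: equiv_def)
  have "(x \<otimes> x', x \<otimes> y') \<in> R" "(y' \<otimes> x, y' \<otimes> y) \<in> R"
    using assms(2) xy xy' carr by blast+
  then show "(x \<otimes> x', y \<otimes> y') \<in> R"
    using assms(1) carr by (auto simp: equiv_def m_comm dest: transD)
qed (rule assms(1))

text \<open>Zorn's lemma, with the diagonal as a first member. Any two pairs in the union of a chain
  lie in a common member, so the union is again a congruence.\<close>

lemma (in monoid) exists_maximal_separating_congruence:
  assumes "a \<noteq> b"
  obtains R where "monoid_congruence G R" "(a, b) \<notin> R"
    "\<And>R'. monoid_congruence G R' \<Longrightarrow> R \<subseteq> R' \<Longrightarrow> (a, b) \<notin> R' \<Longrightarrow> R' = R"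
proof -
  define \<A> where "\<A> = {R. monoid_congruence G R \<and> (a, b) \<notin> R}"
  have "Id_on (carrier G) \<in> \<A>"
    using assms unfolding \<A>_def monoid_congruence_def
    by (auto simp: equiv_def refl_on_def sym_def trans_def)
  moreover have "\<Union>\<C> \<in> \<A>" if ne: "\<C> \<noteq> {}" and ch: "subset.chain \<A> \<C>" for \<C>
  proof -
    have sub: "\<C> \<subseteq> \<A>" and lin: "\<And>R S. R \<in> \<C> \<Longrightarrow> S \<in> \<C> \<Longrightarrow> R \<subseteq> S \<or> S \<subseteq> R"
      using ch by (auto simp: subset_chain_def)
    have cong: "monoid_congruence G R" if "R \<in> \<C>" for R
      using sub that by (auto simp: \<A>_def)
    have common: "\<exists>R\<in>\<C>. p \<in> R \<and> q \<in> R" if "p \<in> \<Union>\<C>" "q \<in> \<Union>\<C>" for p q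
      using that lin by blast
    have "equiv (carrier G) (\<Union>\<C>)"
    proof (rule equivI)
      show "\<Union>\<C> \<subseteq> carrier G \<times> carrier G"
        using cong monoid_congruenceD(4,5) by fastforce
      show "refl_on (carrier G) (\<Union>\<C>)"
        using ne cong monoid_congruenceD(1) unfolding refl_on_def by fast
      show "sym (\<Union>\<C>)"
        using cong monoid_congruenceD(2) unfolding sym_def by fast
      show "trans (\<Union>\<C>)"
        unfolding trans_def using common cong monoid_congruenceD(3) by (meson UnionI)
    qed
    moreover have "(x \<otimes> x', y \<otimes> y') \<in> \<Union>\<C>" if "(x, y) \<in> \<Union>\<C>" "(x', y') \<in> \<Union>\<C>" for x y x' y'
      using common[OF that] cong monoid_congruenceD(6) by (meson UnionI)
    ultimately show ?thesis
      using sub unfolding \<A>_def monoid_congruence_def by blast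
  qed
  ultimately have "\<exists>R\<in>\<A>. \<forall>S\<in>\<A>. R \<subseteq> S \<longrightarrow> S = R"
    by (intro subset_Zorn_nonempty) auto
  then show thesis
    using that unfolding \<A>_def by blast
qed

section \<open>Ascending chains of congruences on a finitely generated commutative monoid\<close>

context comm_monoid
begin

text \<open>By commutativity the monomials are closed under products, so they form a submonoid
  containing the generating set.\<close>

lemma generated_by_monomials:
  assumes "finitely_generated_monoid G"
  obtains k :: nat and g :: "nat \<Rightarrow> 'a" where "\<And>i. i < k \<Longrightarrow> g i \<in> carrier G"
    and "carrier G = (\<lambda>e. \<Otimes>i\<in>{..<k}. g i [^] (e i :: nat)) ` UNIV"
proof -
  obtain S where S: "finite S" "S \<subseteq> carrier G" "(\<lambda>H. submonoid H G) hull S = carrier G"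
    using assms unfolding finitely_generated_monoid_def by blast
  obtain k and g :: "nat \<Rightarrow> 'a" where g: "S = g ` {i. i < k}"
    using finite_imp_nat_seg_image_inj_on[OF S(1)] by blast
  have gc: "g i \<in> carrier G" if "i < k" for i
    using S(2) g that by blast
  define \<phi> where "\<phi> e = (\<Otimes>i\<in>{..<k}. g i [^] (e i :: nat))" for e
  have \<phi>_closed: "\<phi> e \<in> carrier G" for e
    unfolding \<phi>_def using gc by (intro finprod_closed) auto
  have "submonoid (range \<phi>) G"
  proof
    show "range \<phi> \<subseteq> carrier G"
      using \<phi>_closed by blast
    have "\<phi> (\<lambda>_. 0) = \<one>"
      unfolding \<phi>_def by simp
    then show "\<one> \<in> range \<phi>"
      by (metis rangeI)
  next
    fix x y assume "x \<in> range \<phi>" "y \<in> range \<phi>"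
    then obtain e f where xy: "x = \<phi> e" "y = \<phi> f"
      by blast
    have "\<phi> (\<lambda>i. e i + f i) = (\<Otimes>i\<in>{..<k}. g i [^] e i \<otimes> g i [^] f i)"
      unfolding \<phi>_def using gc by (intro finprod_cong') (auto simp: nat_pow_mult)
    also have "\<dots> = x \<otimes> y"
      unfolding xy \<phi>_def using gc by (intro finprod_multf) auto
    finally show "x \<otimes> y \<in> range \<phi>"
      by (metis rangeI)
  qed
  moreover have "S \<subseteq> range \<phi>"
  proof
    fix s assume "s \<in> S"
    then obtain j where j: "s = g j" "j < k"
      using g by blast
    have "\<phi> (\<lambda>i. if j = i then 1 else 0) = (\<Otimes>i\<in>{..<k}. if j = i then g i else \<one>)"
      unfolding \<phi>_def using gc by (intro finprod_cong') auto
    also have "\<dots> = s"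
      using gc j finprod_singleton[of j "{..<k}" g] by auto
    finally show "s \<in> range \<phi>"
      by (metis rangeI)
  qed
  ultimately have "carrier G \<subseteq> range \<phi>"
    using hull_minimal[of S "range \<phi>" "\<lambda>H. submonoid H G"] S(3) by simp
  then have "carrier G = range \<phi>"
    using \<phi>_closed by blast
  then show thesis
    using that[of k g] gc unfolding \<phi>_def by simp
qed

text \<open>The map \<open>\<phi>\<close> from multisets over the generators to \<open>G\<close> is
  a surjective homomorphism. Pulling the chain back along it reduces the claim to multisets, and
  surjectivity carries the equality \<open>E (Suc n) = E n\<close> back to \<open>R\<close>.\<close>

lemma congruence_chain_stabilizes:
  assumes "finitely_generated_monoid G"
    and cong: "\<And>n :: nat. monoid_congruence G (R n)"
    and chain: "\<And>n. R n \<subseteq> R (Suc n)"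
  shows "\<exists>n. R (Suc n) = R n"
proof -
  obtain k and g :: "nat \<Rightarrow> 'a" where gc: "\<And>i. i < k \<Longrightarrow> g i \<in> carrier G"
    and gen: "carrier G = (\<lambda>e. \<Otimes>i\<in>{..<k}. g i [^] (e i :: nat)) ` UNIV"
    using generated_by_monomials[OF assms(1)] by blast
  define \<phi> where "\<phi> X = (\<Otimes>i\<in>{..<k}. g i [^] count X i)" for X
  define D where "D = {X. set_mset X \<subseteq> {..<k}}"
  have \<phi>_closed: "\<phi> X \<in> carrier G" for X
    unfolding \<phi>_def using gc by (intro finprod_closed) auto
  have \<phi>_add: "\<phi> (X + Y) = \<phi> X \<otimes> \<phi> Y" for X Y
  proof -
    have "\<phi> (X + Y) = (\<Otimes>i\<in>{..<k}. g i [^] count X i \<otimes> g i [^] count Y i)"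
      unfolding \<phi>_def using gc by (intro finprod_cong') (auto simp: nat_pow_mult)
    also have "\<dots> = \<phi> X \<otimes> \<phi> Y"
      unfolding \<phi>_def using gc by (intro finprod_multf) auto
    finally show ?thesis .
  qed
  have \<phi>_surj: "\<exists>X\<in>D. \<phi> X = x" if x: "x \<in> carrier G" for x
  proof -
    obtain e :: "nat \<Rightarrow> nat" where e: "x = (\<Otimes>i\<in>{..<k}. g i [^] e i)"
      using gen x by blast
    \<comment> \<open>Exponents from \<open>k\<close> on are cut off: a multiset has finite support,
      and \<open>X\<close> has to lie in \<open>D\<close>.\<close>
    define X where "X = Abs_multiset (\<lambda>i. if i < k then e i else 0)"
    have count: "count X i = (if i < k then e i else 0)" for i
      unfolding X_def by (subst count_Abs_multiset) auto
    have "\<phi> X = x"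
      unfolding \<phi>_def e using gc by (intro finprod_cong') (auto simp: count)
    moreover have "X \<in> D"
      unfolding D_def by (auto simp: count simp flip: count_greater_zero_iff split: if_splits)
    ultimately show ?thesis by blast
  qed
  define E where "E n = {(X, Y) \<in> D \<times> D. (\<phi> X, \<phi> Y) \<in> R n}" for n
  note congD = monoid_congruenceD[OF cong]
  have "\<exists>n. E (Suc n) = E n"
  proof (rule multiset_congruence_chain_stabilizes[where I = "{..<k}", folded D_def])
    show "equiv D (E n)" for n
    proof (rule equivI)
      show "refl_on D (E n)"
        using congD(1)[OF \<phi>_closed] unfolding E_def by (simp add: refl_on_def)
      show "sym (E n)"
        using congD(2)[of _ _ n] unfolding E_def by (auto intro: symI)
      show "trans (E n)"
        using congD(3)[of _ _ n] unfolding E_def by (blast intro: transI)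
    qed (auto simp: E_def)
    show "(X + Z, Y + Z) \<in> E n" if "(X, Y) \<in> E n" "Z \<in> D" for n X Y Z
    proof -
      have "(\<phi> (X + Z), \<phi> (Y + Z)) \<in> R n"
        unfolding \<phi>_add using that(1) by (intro congD(6) congD(1)[OF \<phi>_closed]) (simp add: E_def)
      with that show ?thesis by (auto simp: E_def D_def)
    qed
    show "E n \<subseteq> E (Suc n)" for n
      using chain[of n] unfolding E_def by auto
  qed simp
  then obtain n where n: "E (Suc n) = E n"
    by blast
  have "(x, y) \<in> R n" if xy: "(x, y) \<in> R (Suc n)" for x y
  proof -
    obtain X Y where "X \<in> D" "Y \<in> D" "\<phi> X = x" "\<phi> Y = y"
      using \<phi>_surj congD(4,5)[OF xy] by metis
    with xy n show ?thesis
      unfolding E_def by auto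
  qed
  with chain show ?thesis
    by (intro exI[of _ n]) auto
qed

section \<open>Powers of an element modulo a maximal congruence\<close>

lemma congruence_left_kernel:
  assumes "monoid_congruence G R" and c: "c \<in> carrier G"
  shows "monoid_congruence G {(x, y) \<in> carrier G \<times> carrier G. (c \<otimes> x, c \<otimes> y) \<in> R}"
proof (rule monoid_congruenceI)
  note congD = monoid_congruenceD[OF assms(1)]
  show "equiv (carrier G) {(x, y) \<in> carrier G \<times> carrier G. (c \<otimes> x, c \<otimes> y) \<in> R}"
  proof (rule equivI)
    show "refl_on (carrier G) {(x, y) \<in> carrier G \<times> carrier G. (c \<otimes> x, c \<otimes> y) \<in> R}"
      using congD(1) c by (simp add: refl_on_def)
    show "sym {(x, y) \<in> carrier G \<times> carrier G. (c \<otimes> x, c \<otimes> y) \<in> R}"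
      using congD(2) by (auto intro: symI)
    show "trans {(x, y) \<in> carrier G \<times> carrier G. (c \<otimes> x, c \<otimes> y) \<in> R}"
      using congD(3) by (blast intro: transI)
  qed auto
  show "(z \<otimes> x, z \<otimes> y) \<in> {(x, y) \<in> carrier G \<times> carrier G. (c \<otimes> x, c \<otimes> y) \<in> R}"
    if "(x, y) \<in> {(x, y) \<in> carrier G \<times> carrier G. (c \<otimes> x, c \<otimes> y) \<in> R}" and z: "z \<in> carrier G"
    for x y z
  proof -
    have xy: "x \<in> carrier G" "y \<in> carrier G" "(c \<otimes> x, c \<otimes> y) \<in> R"
      using that by auto
    have "(z \<otimes> (c \<otimes> x), z \<otimes> (c \<otimes> y)) \<in> R"
      using congD(6)[OF congD(1)[OF z] xy(3)] .
    with xy(1,2) c z show ?thesis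
      by (simp add: m_lcomm)
  qed
qed

text \<open>The left kernels of the powers of \<open>c\<close> ascend, so two consecutive ones are
  equal.\<close>

lemma congruence_left_kernel_power_stabilizes:
  assumes "finitely_generated_monoid G" and cong: "monoid_congruence G R" and c: "c \<in> carrier G"
  obtains n :: nat where "n > 0"
    and "\<And>x y m. x \<in> carrier G \<Longrightarrow> y \<in> carrier G \<Longrightarrow>
      (c [^] (n + m) \<otimes> x, c [^] (n + m) \<otimes> y) \<in> R \<Longrightarrow> (c [^] n \<otimes> x, c [^] n \<otimes> y) \<in> R"
proof -
  note congD = monoid_congruenceD[OF cong]
  define K where
    "K n = {(x, y) \<in> carrier G \<times> carrier G. (c [^] (n :: nat) \<otimes> x, c [^] n \<otimes> y) \<in> R}" for n
  have step: "(c [^] Suc n \<otimes> x, c [^] Suc n \<otimes> y) \<in> R"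
    if "(c [^] n \<otimes> x, c [^] n \<otimes> y) \<in> R" "x \<in> carrier G" "y \<in> carrier G" for n x y
  proof -
    have "c [^] Suc n \<otimes> z = c \<otimes> (c [^] n \<otimes> z)" if "z \<in> carrier G" for z
      using c that by (simp add: m_ac)
    with congD(6)[OF congD(1)[OF c] that(1)] that(2,3) show ?thesis
      by simp
  qed
  have "\<exists>n. K (Suc n) = K n"
  proof (rule congruence_chain_stabilizes[OF assms(1)])
    show "monoid_congruence G (K n)" for n
      unfolding K_def using cong c by (intro congruence_left_kernel) auto
    show "K n \<subseteq> K (Suc n)" for n
      unfolding K_def using step by auto
  qed
  then obtain n where n: "K (Suc n) = K n"
    by blast
  have shift: "(x, y) \<in> K (Suc p) \<longleftrightarrow> (c \<otimes> x, c \<otimes> y) \<in> K p"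
    if "x \<in> carrier G" "y \<in> carrier G" for x y p
    using that c unfolding K_def by (auto simp: m_assoc)
  \<comment> \<open>By \<open>shift\<close>, \<open>K (Suc p)\<close> is the preimage of
    \<open>K p\<close> under multiplication by \<open>c\<close>, so one coincidence of neighbours
    propagates to all later kernels.\<close>
  have stable: "K (n + p) = K n" for p
  proof (induction p)
    case (Suc p)
    have sub: "K q \<subseteq> carrier G \<times> carrier G" for q
      unfolding K_def by auto
    have "(x, y) \<in> K (n + Suc p) \<longleftrightarrow> (x, y) \<in> K n" if "x \<in> carrier G" "y \<in> carrier G" for x y
      using shift[OF that, of "n + p"] shift[OF that, of n] Suc.IH n by simp
    then show ?case
      using sub[of n] sub[of "n + Suc p"] by (intro equalityI subrelI) blast+
  qed simp
  show thesis
  \<comment> \<open>\<open>Suc n\<close> rather than \<open>n\<close> makes the exponent positive,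
    so that a factor \<open>c\<close> can be split off later.\<close>
  proof (rule that[of "Suc n"])
    fix x y m
    assume "x \<in> carrier G" "y \<in> carrier G" "(c [^] (Suc n + m) \<otimes> x, c [^] (Suc n + m) \<otimes> y) \<in> R"
    then have "(x, y) \<in> K (n + Suc m)"
      unfolding K_def by simp
    then have "(x, y) \<in> K (Suc n)"
      using stable[of "Suc m"] n by simp
    then show "(c [^] Suc n \<otimes> x, c [^] Suc n \<otimes> y) \<in> R"
      unfolding K_def by simp
  qed simp
qed

text \<open>By maximality, the kernel \<open>K\<close> of multiplication by the power
  \<open>d\<close> of \<open>c\<close> either is \<open>R\<close>, and then \<open>c\<close>, a
  factor of \<open>d\<close>, is cancellable; or it relates \<open>a\<close> to \<open>b\<close>,
  and then the multiples of \<open>d\<close> form a single class, which makes \<open>d\<close> a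
  zero.\<close>

lemma zero_or_cancellable_mod_maximal_congruence:
  assumes "finitely_generated_monoid G" and cong: "monoid_congruence G R" and ab: "(a, b) \<notin> R"
    and maximal: "\<And>R'. monoid_congruence G R' \<Longrightarrow> R \<subseteq> R' \<Longrightarrow> (a, b) \<notin> R' \<Longrightarrow> R' = R"
    and c: "c \<in> carrier G"
  obtains (zero) n :: nat where "\<And>x. x \<in> carrier G \<Longrightarrow> (c [^] n \<otimes> x, c [^] n) \<in> R"
  | (cancel) "\<And>x y. x \<in> carrier G \<Longrightarrow> y \<in> carrier G \<Longrightarrow> (c \<otimes> x, c \<otimes> y) \<in> R \<Longrightarrow> (x, y) \<in> R"
proof -
  note congD = monoid_congruenceD[OF cong]
  obtain n :: nat where n: "n > 0"
    and stable: "\<And>x y m. x \<in> carrier G \<Longrightarrow> y \<in> carrier G \<Longrightarrow>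
      (c [^] (n + m) \<otimes> x, c [^] (n + m) \<otimes> y) \<in> R \<Longrightarrow> (c [^] n \<otimes> x, c [^] n \<otimes> y) \<in> R"
    using congruence_left_kernel_power_stabilizes[OF assms(1) cong c] by blast
  define d where "d = c [^] n"
  have d: "d \<in> carrier G"
    using c by (simp add: d_def)
  have stable_d: "(d \<otimes> x, d \<otimes> y) \<in> R"
    if "x \<in> carrier G" "y \<in> carrier G" "(d \<otimes> (d \<otimes> x), d \<otimes> (d \<otimes> y)) \<in> R" for x y
    using stable[of x y n] that c unfolding d_def by (simp add: nat_pow_mult[symmetric] m_assoc)
  define K where "K = {(x, y) \<in> carrier G \<times> carrier G. (d \<otimes> x, d \<otimes> y) \<in> R}"
  have K_cong: "monoid_congruence G K"
    unfolding K_def using cong d by (rule congruence_left_kernel)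
  have R_K: "R \<subseteq> K"
    unfolding K_def using congD(4,5) congD(6)[OF congD(1)[OF d]] by auto
  show thesis
  proof (cases "(a, b) \<in> K")
    case False
    then have K: "K = R"
      by (rule maximal[OF K_cong R_K])
    have "(x, y) \<in> R" if xy: "x \<in> carrier G" "y \<in> carrier G" "(c \<otimes> x, c \<otimes> y) \<in> R" for x y
    proof -
      obtain k where k: "n = Suc k"
        using n by (cases n) auto
      have "(c [^] k \<otimes> (c \<otimes> x), c [^] k \<otimes> (c \<otimes> y)) \<in> R"
        by (rule congD(6)[OF congD(1) xy(3)]) (use c in simp)
      then have "(d \<otimes> x, d \<otimes> y) \<in> R"
        using xy c unfolding d_def k by (simp add: m_assoc)
      with xy have "(x, y) \<in> K"
        unfolding K_def by simp
      with K show ?thesis by simp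
    qed
    then show thesis by (rule cancel)
  next
    case abK: True
    text \<open>
      Collapsing the ideal \<open>J\<close> generated by \<open>d\<close> does not identify \<open>a\<close> with \<open>b\<close>: by stability, elements
      of \<open>J\<close> with the same multiple by \<open>d\<close> are already equal.
    \<close>
    define J where "J = {x. \<exists>u\<in>carrier G. (x, d \<otimes> u) \<in> R}"
    have J_R: "x \<in> J" if "(x, y) \<in> R" "y \<in> J" for x y
      using that congD(3) unfolding J_def by blast
    have J_R': "y \<in> J" if "(x, y) \<in> R" "x \<in> J" for x y
      using J_R congD(2) that by blast
    have J_carrier: "J \<subseteq> carrier G"
      using congD(4) unfolding J_def by blast
    have J_ideal: "z \<otimes> x \<in> J" if x: "x \<in> J" and z: "z \<in> carrier G" for x z
    proof -
      obtain u where u: "u \<in> carrier G" "(x, d \<otimes> u) \<in> R"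
        using x unfolding J_def by blast
      have "(z \<otimes> x, z \<otimes> (d \<otimes> u)) \<in> R"
        using u(2) z by (intro congD(6) congD(1))
      then have "(z \<otimes> x, d \<otimes> (z \<otimes> u)) \<in> R"
        using z d u(1) by (simp add: m_lcomm)
      with z u(1) show ?thesis
        unfolding J_def by blast
    qed
    have "monoid_congruence G (R \<union> J \<times> J)"
    proof (rule monoid_congruenceI)
      show "equiv (carrier G) (R \<union> J \<times> J)"
      proof (rule equivI)
        show "R \<union> J \<times> J \<subseteq> carrier G \<times> carrier G"
          using congD(4,5) J_carrier by auto
        show "refl_on (carrier G) (R \<union> J \<times> J)"
          using congD(1) by (simp add: refl_on_def)
        show "sym (R \<union> J \<times> J)"
          using congD(2) by (auto intro: symI)
        show "trans (R \<union> J \<times> J)"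
          using congD(3) J_R J_R' by (intro transI) blast
      qed
      show "(z \<otimes> x, z \<otimes> y) \<in> R \<union> J \<times> J"
        if "(x, y) \<in> R \<union> J \<times> J" "z \<in> carrier G" for x y z
        using that J_ideal congD(6)[OF congD(1)[of z]] by blast
    qed
    moreover have "(a, b) \<notin> R \<union> J \<times> J"
    proof
      assume "(a, b) \<in> R \<union> J \<times> J"
      with ab obtain u v where u: "u \<in> carrier G" "(a, d \<otimes> u) \<in> R"
        and v: "v \<in> carrier G" "(b, d \<otimes> v) \<in> R"
        unfolding J_def by blast
      have "(d \<otimes> a, d \<otimes> (d \<otimes> u)) \<in> R" "(d \<otimes> b, d \<otimes> (d \<otimes> v)) \<in> R"
        using u v d by (auto intro!: congD(6) congD(1))
      moreover have "(d \<otimes> a, d \<otimes> b) \<in> R"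
        using abK unfolding K_def by simp
      ultimately have "(d \<otimes> (d \<otimes> u), d \<otimes> (d \<otimes> v)) \<in> R"
        using congD(2,3) by blast
      then have "(d \<otimes> u, d \<otimes> v) \<in> R"
        by (rule stable_d[OF u(1) v(1)])
      with u(2) v(2) ab show False
        using congD(2,3) by blast
    qed
    ultimately have "R \<union> J \<times> J = R"
      using maximal by blast
    moreover have "d \<otimes> x \<in> J" if "x \<in> carrier G" for x
      using that d congD(1)[of "d \<otimes> x"] unfolding J_def by auto
    ultimately have "(d \<otimes> x, d \<otimes> \<one>) \<in> R" if "x \<in> carrier G" for x
      using that by blast
    then show thesis
      using zero[of n] d unfolding d_def by simp
  qed
qed

text \<open>
  Unless \<open>c\<close> has finite order, \<open>a\<close> and \<open>b\<close> become equal when the powers of \<open>c [^] q\<close> are collapsed,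
  for every \<open>q\<close>. If the case \<open>q = 1\<close> gives the exponents \<open>i\<close>, \<open>j\<close>, comparison with the case
  \<open>q = 2 \<bar>i - j\<bar>\<close> yields a nontrivial power of \<open>c\<close> that fixes both \<open>a\<close> and \<open>b\<close>.
\<close>

lemma finite_order_mod_maximal_congruence:
  assumes cong: "monoid_congruence G R" and ab: "(a, b) \<notin> R"
    and maximal: "\<And>R'. monoid_congruence G R' \<Longrightarrow> R \<subseteq> R' \<Longrightarrow> (a, b) \<notin> R' \<Longrightarrow> R' = R"
    and c: "c \<in> carrier G"
    and cancel: "\<And>x y. x \<in> carrier G \<Longrightarrow> y \<in> carrier G \<Longrightarrow> (c \<otimes> x, c \<otimes> y) \<in> R \<Longrightarrow> (x, y) \<in> R"
  obtains p :: nat where "p > 0" "(c [^] p, \<one>) \<in> R"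
proof (rule ccontr)
  assume "\<not> thesis"
  with that have infinite_order: "(c [^] p, \<one>) \<notin> R" if "p > 0" for p :: nat
    using that by blast
  note congD = monoid_congruenceD[OF cong]
  have pow: "c [^] (n :: nat) \<in> carrier G" for n
    using c by simp
  have pow_add: "c [^] (m + n) \<otimes> x = c [^] m \<otimes> (c [^] n \<otimes> x)" if "x \<in> carrier G" for m n :: nat and x
    using c that by (simp add: nat_pow_mult[symmetric] m_assoc)
  have mult: "(c [^] (m + i) \<otimes> x, c [^] (m + j) \<otimes> y) \<in> R"
    if "x \<in> carrier G" "y \<in> carrier G" "(c [^] i \<otimes> x, c [^] j \<otimes> y) \<in> R" for m i j :: nat and x y
    using that pow by (simp add: pow_add congD(1,6))
  have cancel_pow: "(x, y) \<in> R"
    if "x \<in> carrier G" "y \<in> carrier G" "(c [^] n \<otimes> x, c [^] n \<otimes> y) \<in> R" for n :: nat and x y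
    using that
  proof (induction n)
    case (Suc n)
    have "c [^] Suc n \<otimes> z = c \<otimes> (c [^] n \<otimes> z)" if "z \<in> carrier G" for z
      using c that by (simp add: m_ac)
    with Suc.prems have "(c \<otimes> (c [^] n \<otimes> x), c \<otimes> (c [^] n \<otimes> y)) \<in> R"
      by metis
    then have "(c [^] n \<otimes> x, c [^] n \<otimes> y) \<in> R"
      by (rule cancel[rotated -1]) (use Suc.prems c in simp_all)
    with Suc show ?case by blast
  qed simp
  \<comment> \<open>\<open>S q\<close> is the congruence generated by \<open>R\<close> and the pair
    of \<open>c [^] q\<close> and \<open>\<one>\<close>. As \<open>c\<close> need not be invertible,
    both sides are multiplied by powers.\<close>
  define S where "S q = {(x, y) \<in> carrier G \<times> carrier G.
    \<exists>i j. (c [^] (q * i :: nat) \<otimes> x, c [^] (q * j) \<otimes> y) \<in> R}" for q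
  have S_cong: "monoid_congruence G (S q)" for q
  proof (rule monoid_congruenceI)
    show "equiv (carrier G) (S q)"
    proof (rule equivI)
      show "S q \<subseteq> carrier G \<times> carrier G"
        unfolding S_def by auto
      show "refl_on (carrier G) (S q)"
        unfolding refl_on_def S_def using congD(1) pow by blast
      show "sym (S q)"
        unfolding S_def using congD(2) by (auto intro!: symI)
      show "trans (S q)"
      proof (rule transI)
        fix x y z assume xy: "(x, y) \<in> S q" and yz: "(y, z) \<in> S q"
        obtain i j where ij: "(c [^] (q * i) \<otimes> x, c [^] (q * j) \<otimes> y) \<in> R"
          using xy unfolding S_def by auto
        obtain k l where kl: "(c [^] (q * k) \<otimes> y, c [^] (q * l) \<otimes> z) \<in> R"
          using yz unfolding S_def by auto
        have carr: "x \<in> carrier G" "y \<in> carrier G" "z \<in> carrier G"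
          using xy yz unfolding S_def by auto
        \<comment> \<open>Multiplying each relation by a power taken from the other gives both the
          middle term \<open>c [^] (q * (k + j)) \<otimes> y\<close>.\<close>
        have "(c [^] (q * (k + i)) \<otimes> x, c [^] (q * (k + j)) \<otimes> y) \<in> R"
          using mult[OF carr(1,2) ij, of "q * k"] by (simp add: distrib_left)
        moreover have "(c [^] (q * (k + j)) \<otimes> y, c [^] (q * (j + l)) \<otimes> z) \<in> R"
          using mult[OF carr(2,3) kl, of "q * j"] by (simp add: distrib_left add.commute)
        ultimately show "(x, z) \<in> S q"
          unfolding S_def using congD(3) carr by blast
      qed
    qed
    fix x y z assume xy: "(x, y) \<in> S q" and z: "z \<in> carrier G"
    obtain i j where ij: "(c [^] (q * i) \<otimes> x, c [^] (q * j) \<otimes> y) \<in> R"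
      and carr: "x \<in> carrier G" "y \<in> carrier G"
      using xy unfolding S_def by auto
    have "(z \<otimes> (c [^] (q * i) \<otimes> x), z \<otimes> (c [^] (q * j) \<otimes> y)) \<in> R"
      by (rule congD(6)[OF congD(1)[OF z] ij])
    then have "(c [^] (q * i) \<otimes> (z \<otimes> x), c [^] (q * j) \<otimes> (z \<otimes> y)) \<in> R"
      using carr z pow by (simp add: m_lcomm)
    then show "(z \<otimes> x, z \<otimes> y) \<in> S q"
      unfolding S_def using carr z by auto
  qed
  have R_S: "R \<subseteq> S q" for q
  proof
    fix p assume "p \<in> R"
    then show "p \<in> S q"
      using congD(4,5) unfolding S_def by (cases p) (auto intro!: exI[of _ "0 :: nat"])
  qed
  \<comment> \<open>Otherwise maximality gives \<open>S q = R\<close>, although \<open>S q\<close>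
    relates \<open>c [^] q\<close> to \<open>\<one>\<close>, contrary to infinite order.\<close>
  have ab_S: "(a, b) \<in> S q" if q: "q > 0" for q
  proof (rule ccontr)
    assume "(a, b) \<notin> S q"
    then have "S q = R"
      by (rule maximal[OF S_cong R_S])
    moreover have "(c [^] (q * 0) \<otimes> c [^] q, c [^] (q * 1) \<otimes> \<one>) \<in> R"
      using congD(1)[OF pow] pow by simp
    then have "(c [^] q, \<one>) \<in> S q"
      unfolding S_def using pow by blast
    ultimately show False
      using infinite_order[OF q] by simp
  qed
  have ab_S_witness: "\<exists>i j. (c [^] (q * i) \<otimes> a, c [^] (q * j) \<otimes> b) \<in> R" if "q > 0" for q :: nat
    using ab_S[OF that] unfolding S_def by auto
  have a: "a \<in> carrier G" and b: "b \<in> carrier G"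
    using ab_S[of 1] unfolding S_def by auto
  obtain i j where ij: "(c [^] (i :: nat) \<otimes> a, c [^] (j :: nat) \<otimes> b) \<in> R"
    using ab_S_witness[of 1] by auto
  have "i \<noteq> j"
    using ij ab cancel_pow[OF a b] by blast
  \<comment> \<open>The factor 2 serves to separate the exponents \<open>u\<close> and
    \<open>v\<close> below: over the integers their difference is an odd multiple of
    \<open>i - j\<close>, hence nonzero.\<close>
  define q where "q = 2 * nat \<bar>int i - int j\<bar>"
  have "q > 0"
    using \<open>i \<noteq> j\<close> unfolding q_def by simp
  then obtain k l where kl: "(c [^] (q * k) \<otimes> a, c [^] (q * l) \<otimes> b) \<in> R"
    using ab_S_witness by blast
  \<comment> \<open>These exponents eliminate \<open>b\<close> from the two relations:
    \<open>c [^] u \<otimes> a\<close> and \<open>c [^] v \<otimes> a\<close> are both related to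
    \<open>c [^] (j + q * l) \<otimes> b\<close>. Eliminating \<open>a\<close> instead leads to the
    same exponents for \<open>b\<close>.\<close>
  define u v where "u = i + q * l" and "v = j + q * k"
  have ij': "(c [^] (w + i) \<otimes> a, c [^] (w + j) \<otimes> b) \<in> R" for w
    using mult[OF a b ij] .
  have kl': "(c [^] (w + q * k) \<otimes> a, c [^] (w + q * l) \<otimes> b) \<in> R" for w
    using mult[OF a b kl] .
  have "(c [^] u \<otimes> a, c [^] v \<otimes> a) \<in> R"
    using congD(3)[OF ij'[of "q * l"] congD(2)[OF kl'[of j, unfolded add.commute[of j "q * l"]]]]
    unfolding u_def v_def by (simp add: add.commute)
  moreover have "(c [^] u \<otimes> b, c [^] v \<otimes> b) \<in> R"
    using congD(3)[OF congD(2)[OF kl'[of i]] ij'[of "q * k", unfolded add.commute[of "q * k" i]]]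
    unfolding u_def v_def by (simp add: add.commute)
  ultimately have uv: "(c [^] u \<otimes> x, c [^] v \<otimes> x) \<in> R" if "x \<in> {a, b}" for x
    using that by auto
  have "u \<noteq> v"
  proof
    assume "u = v"
    then have "int j - int i = int q * (int l - int k)"
      unfolding u_def v_def by (simp add: algebra_simps flip: of_nat_add of_nat_mult)
    then have "\<bar>int j - int i\<bar> = \<bar>int q * (int l - int k)\<bar>"
      by (rule arg_cong)
    also have "\<dots> = \<bar>int j - int i\<bar> * (2 * \<bar>int l - int k\<bar>)"
      by (simp add: q_def abs_mult abs_minus_commute)
    finally have "1 = 2 * \<bar>int l - int k\<bar>"
      using \<open>i \<noteq> j\<close> by (metis abs_eq_0 mult.right_neutral mult_cancel_left of_nat_eq_iff right_minus_eq)
    then show False by presburger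
  qed
  define p where "p = (if u < v then v - u else u - v)"
  have "p > 0"
    using \<open>u \<noteq> v\<close> unfolding p_def by auto
  have fix1: "(c [^] p \<otimes> x, x) \<in> R" if x: "x \<in> {a, b}" for x
  proof (cases "u < v")
    case True
    have carr: "x \<in> carrier G"
      using x a b by auto
    have "(c [^] u \<otimes> x, c [^] u \<otimes> (c [^] p \<otimes> x)) \<in> R"
      using uv[OF x] pow_add[OF carr, of u p] True by (simp add: p_def)
    then show ?thesis
      using cancel_pow[of "x" "c [^] p \<otimes> x" u] carr pow congD(2) by simp
  next
    case False
    have carr: "x \<in> carrier G"
      using x a b by auto
    have "(c [^] v \<otimes> (c [^] p \<otimes> x), c [^] v \<otimes> x) \<in> R"
      using uv[OF x] pow_add[OF carr, of v p] False \<open>u \<noteq> v\<close> by (simp add: p_def)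
    then show ?thesis
      using cancel_pow[of "c [^] p \<otimes> x" x v] carr pow by simp
  qed
  have fix_all: "(c [^] (p * n) \<otimes> x, x) \<in> R" if x: "x \<in> {a, b}" for x and n :: nat
  proof (induction n)
    case 0
    show ?case using x a b congD(1) by auto
  next
    case (Suc n)
    have carr: "x \<in> carrier G"
      using x a b by auto
    have "(c [^] p \<otimes> (c [^] (p * n) \<otimes> x), c [^] p \<otimes> x) \<in> R"
      using Suc pow by (intro congD(6) congD(1))
    then have "(c [^] (p * Suc n) \<otimes> x, c [^] p \<otimes> x) \<in> R"
      using carr by (simp add: pow_add)
    with fix1[OF x] show ?case
      using congD(3) by blast
  qed
  \<comment> \<open>Collapsing the powers of \<open>c [^] p\<close> also relates \<open>a\<close> to
    \<open>b\<close>, but these powers fix both of them modulo \<open>R\<close>.\<close>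
  obtain m n where "(c [^] (p * m) \<otimes> a, c [^] (p * n) \<otimes> b) \<in> R"
    using ab_S_witness[OF \<open>p > 0\<close>] by blast
  from congD(3)[OF congD(2)[OF fix_all] congD(3)[OF this fix_all]] have "(a, b) \<in> R"
    by simp
  with ab show False ..
qed

text \<open>If \<open>c [^] n\<close> is a zero, exponents above \<open>n\<close> may be replaced by
  \<open>n\<close>; if \<open>c\<close> has finite order, exponents are reduced modulo that
  order.\<close>

lemma powers_finite_mod_maximal_congruence:
  assumes "finitely_generated_monoid G" and cong: "monoid_congruence G R" and ab: "(a, b) \<notin> R"
    and maximal: "\<And>R'. monoid_congruence G R' \<Longrightarrow> R \<subseteq> R' \<Longrightarrow> (a, b) \<notin> R' \<Longrightarrow> R' = R"
    and c: "c \<in> carrier G"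
  shows "\<exists>N :: nat. \<forall>e :: nat. \<exists>e'<N. (c [^] e, c [^] e') \<in> R"
proof -
  note congD = monoid_congruenceD[OF cong]
  have pow: "c [^] (n :: nat) \<in> carrier G" for n
    using c by simp
  show ?thesis
  proof (rule zero_or_cancellable_mod_maximal_congruence[OF assms])
    fix n :: nat
    assume zero: "\<And>x. x \<in> carrier G \<Longrightarrow> (c [^] n \<otimes> x, c [^] n) \<in> R"
    have "\<exists>e'<Suc n. (c [^] e, c [^] e') \<in> R" for e :: nat
    proof (cases "e \<le> n")
      case True
      then show ?thesis
        using congD(1)[OF pow] by (intro exI[of _ e]) simp
    next
      case False
      then have "c [^] e = c [^] n \<otimes> c [^] (e - n)"
        using c by (simp add: nat_pow_mult)
      then show ?thesis
        using zero[OF pow] by (intro exI[of _ n]) simp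
    qed
    then show ?thesis by blast
  next
    assume cancel: "\<And>x y. x \<in> carrier G \<Longrightarrow> y \<in> carrier G \<Longrightarrow> (c \<otimes> x, c \<otimes> y) \<in> R \<Longrightarrow> (x, y) \<in> R"
    obtain p :: nat where p: "p > 0" "(c [^] p, \<one>) \<in> R"
      using finite_order_mod_maximal_congruence[OF cong ab maximal c cancel] by blast
    have one: "(c [^] (p * n), \<one>) \<in> R" for n :: nat
    proof (induction n)
      case 0
      show ?case using congD(1) by simp
    next
      case (Suc n)
      show ?case
        using congD(6)[OF p(2) Suc] c by (simp add: nat_pow_mult)
    qed
    have "(c [^] e, c [^] (e mod p)) \<in> R" for e :: nat
    proof -
      have "c [^] e = c [^] (p * (e div p)) \<otimes> c [^] (e mod p)"
        using c by (simp add: nat_pow_mult)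
      then show ?thesis
        using congD(6)[OF one congD(1)[OF pow], of "e div p" "e mod p"] pow by simp
    qed
    then show ?thesis
      using p(1) mod_less_divisor by blast
  qed
qed

section \<open>Residual finiteness\<close>

lemma finprod_congruence:
  assumes cong: "monoid_congruence G R" and "finite I" and "\<And>i. i \<in> I \<Longrightarrow> (f i, g i) \<in> R"
  shows "(finprod G f I, finprod G g I) \<in> R"
  using assms(2,3)
proof (induction I)
  case empty
  show ?case using monoid_congruenceD(1)[OF cong] by simp
next
  case (insert i I)
  have "f \<in> I \<rightarrow> carrier G" "f i \<in> carrier G" "g \<in> I \<rightarrow> carrier G" "g i \<in> carrier G"
    using insert.prems monoid_congruenceD(4,5)[OF cong] by blast+
  with insert show ?case
    by (simp add: monoid_congruenceD(6)[OF cong])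
qed

text \<open>A maximal separating congruence already has finite index: modulo it each generator has
  finitely many powers, so every monomial is related to one with exponents in the finite box
  \<open>P\<close>.\<close>

lemma finite_index_separating_congruence:
  assumes fg: "finitely_generated_monoid G" and "a \<noteq> b"
  obtains R where "monoid_congruence G R" "finite (carrier G // R)" "(a, b) \<notin> R"
proof -
  obtain R where R: "monoid_congruence G R" "(a, b) \<notin> R"
    and maximal: "\<And>R'. monoid_congruence G R' \<Longrightarrow> R \<subseteq> R' \<Longrightarrow> (a, b) \<notin> R' \<Longrightarrow> R' = R"
    using exists_maximal_separating_congruence[OF assms(2)] by blast
  obtain k and g :: "nat \<Rightarrow> 'a" where gc: "\<And>i. i < k \<Longrightarrow> g i \<in> carrier G"
    and gen: "carrier G = (\<lambda>e. \<Otimes>i\<in>{..<k}. g i [^] (e i :: nat)) ` UNIV"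
    using generated_by_monomials[OF fg] by blast
  have "\<exists>N :: nat. \<forall>e :: nat. \<exists>e'<N. (g i [^] e, g i [^] e') \<in> R" if "i < k" for i
    using powers_finite_mod_maximal_congruence[OF fg R maximal gc[OF that]] .
  then obtain N :: "nat \<Rightarrow> nat"
    where N: "\<And>i e. i < k \<Longrightarrow> \<exists>e'<N i. (g i [^] (e :: nat), g i [^] e') \<in> R"
    by metis
  define P where "P = PiE {..<k} (\<lambda>i. {..<N i})"
  have "carrier G // R \<subseteq> (\<lambda>e. R `` {\<Otimes>i\<in>{..<k}. g i [^] e i}) ` P"
  proof
    fix X assume "X \<in> carrier G // R"
    then obtain x where x: "x \<in> carrier G" "X = R `` {x}"
      by (auto elim: quotientE)
    obtain e :: "nat \<Rightarrow> nat" where e: "x = (\<Otimes>i\<in>{..<k}. g i [^] e i)"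
      using x(1) gen by blast
    have "\<forall>i. \<exists>e'. i < k \<longrightarrow> e' < N i \<and> (g i [^] e i, g i [^] e') \<in> R"
      using N by blast
    then obtain e' where e': "\<And>i. i < k \<Longrightarrow> e' i < N i" "\<And>i. i < k \<Longrightarrow> (g i [^] e i, g i [^] e' i) \<in> R"
      by metis
    define f where "f = restrict e' {..<k}"
    have "f \<in> P"
      using e'(1) unfolding f_def P_def by auto
    moreover have "(x, \<Otimes>i\<in>{..<k}. g i [^] f i) \<in> R"
      unfolding e f_def using e'(2) by (intro finprod_congruence[OF R(1)]) auto
    then have "X = R `` {\<Otimes>i\<in>{..<k}. g i [^] f i}"
      using R(1) x(2) equiv_class_eq unfolding monoid_congruence_def by metis
    ultimately show "X \<in> (\<lambda>e. R `` {\<Otimes>i\<in>{..<k}. g i [^] e i}) ` P"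
      by blast
  qed
  moreover have "finite P"
    unfolding P_def by (intro finite_PiE) auto
  ultimately have "finite (carrier G // R)"
    by (meson finite_imageI finite_subset)
  with R that show thesis by blast
qed

text \<open>Separating congruences for the single pairs are intersected; each class of an
  intersection is an intersection of classes, so the index stays finite.\<close>

lemma finite_index_congruence_avoiding_pairs:
  assumes "finitely_generated_monoid G" and "finite P" and "\<And>a. (a, a) \<notin> P"
  shows "\<exists>R. monoid_congruence G R \<and> finite (carrier G // R) \<and> R \<inter> P = {}"
  using assms(2,3)
proof (induction P)
  case empty
  have "equiv (carrier G) (carrier G \<times> carrier G)"
    by (auto simp: equiv_def refl_on_def sym_def trans_def)
  then have "monoid_congruence G (carrier G \<times> carrier G)"
    by (rule monoid_congruenceI) auto
  moreover have "carrier G // (carrier G \<times> carrier G) \<subseteq> {carrier G}"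
    by (auto simp: quotient_def)
  then have "finite (carrier G // (carrier G \<times> carrier G))"
    by (rule finite_subset) simp
  ultimately show ?case by blast
next
  case (insert p P)
  obtain R where R: "monoid_congruence G R" "finite (carrier G // R)" "R \<inter> P = {}"
    using insert.IH insert.prems by blast
  obtain a b where p: "p = (a, b)" "a \<noteq> b"
    using insert.prems by (cases p) auto
  obtain S where S: "monoid_congruence G S" "finite (carrier G // S)" "(a, b) \<notin> S"
    using finite_index_separating_congruence[OF assms(1) p(2)] by blast
  have "equiv (carrier G) (R \<inter> S)"
    using R(1) S(1) unfolding monoid_congruence_def equiv_def
    by (auto simp: refl_on_def intro: sym_Int trans_Int)
  then have "monoid_congruence G (R \<inter> S)"
    using R(1) S(1) unfolding monoid_congruence_def by blast
  moreover have "carrier G // (R \<inter> S) \<subseteq> (\<lambda>(X, Y). X \<inter> Y) ` (carrier G // R \<times> carrier G // S)"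
  proof
    fix X assume "X \<in> carrier G // (R \<inter> S)"
    then obtain x where "x \<in> carrier G" "X = R `` {x} \<inter> S `` {x}"
      by (auto elim!: quotientE)
    then show "X \<in> (\<lambda>(X, Y). X \<inter> Y) ` (carrier G // R \<times> carrier G // S)"
      by (auto intro: quotientI)
  qed
  then have "finite (carrier G // (R \<inter> S))"
    by (rule finite_subset) (intro finite_imageI finite_cartesian_product R(2) S(2))
  ultimately show ?case
    using R(3) S(3) p(1) by blast
qed

end

section \<open>Cellular automata: periodic configurations and compactness\<close>

definition periodic_configs :: "('a, 'c) monoid_scheme \<Rightarrow> 'b set \<Rightarrow> 'a rel \<Rightarrow> ('a \<Rightarrow> 'b) set" where
  "periodic_configs M A R = {x \<in> configs M A. \<forall>(m, n)\<in>R. x m = x n}"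

lemma finite_periodic_configs:
  assumes cong: "monoid_congruence M R" and "finite (carrier M // R)" and "finite A"
  shows "finite (periodic_configs M A R)"
proof (rule finite_subset)
  show "periodic_configs M A R \<subseteq>
      (\<lambda>h. \<lambda>m\<in>carrier M. h (R `` {m})) ` ((carrier M // R) \<rightarrow>\<^sub>E A)"
  proof
    fix x assume x: "x \<in> periodic_configs M A R"
    define h where "h = (\<lambda>Q\<in>carrier M // R. x (SOME m. m \<in> Q))"
    have rep: "(SOME n. n \<in> R `` {m}) \<in> R `` {m}" if "m \<in> carrier M" for m
      using monoid_congruenceD(1)[OF cong that] by (intro someI[of "\<lambda>n. n \<in> R `` {m}" m]) simp
    have hx: "h (R `` {m}) = x m" if m: "m \<in> carrier M" for m
    proof -
      have "(m, SOME n. n \<in> R `` {m}) \<in> R"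
        using rep[OF m] by blast
      then have "x m = x (SOME n. n \<in> R `` {m})"
        using x unfolding periodic_configs_def by blast
      with m show ?thesis
        unfolding h_def by (simp add: quotientI)
    qed
    have xA: "x \<in> carrier M \<rightarrow>\<^sub>E A"
      using x unfolding periodic_configs_def configs_def by simp
    have "h Q \<in> A" if "Q \<in> carrier M // R" for Q
      using that
    proof (rule quotientE)
      fix m assume "Q = R `` {m}" "m \<in> carrier M"
      with hx xA show "h Q \<in> A" by auto
    qed
    then have "h \<in> (carrier M // R) \<rightarrow>\<^sub>E A"
      unfolding h_def by auto
    moreover have "x = (\<lambda>m\<in>carrier M. h (R `` {m}))"
    proof
      show "x m = (\<lambda>m\<in>carrier M. h (R `` {m})) m" for m
        using hx PiE_arb[OF xA] by (cases "m \<in> carrier M") simp_all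
    qed
    ultimately show "x \<in> (\<lambda>h. \<lambda>m\<in>carrier M. h (R `` {m})) ` ((carrier M // R) \<rightarrow>\<^sub>E A)"
      by blast
  qed
  show "finite ((\<lambda>h. \<lambda>m\<in>carrier M. h (R `` {m})) ` ((carrier M // R) \<rightarrow>\<^sub>E A))"
    using assms(2,3) by (intro finite_imageI finite_PiE)
qed

context monoid
begin

text \<open>For related \<open>m\<close> and \<open>n\<close> the shifts of \<open>x\<close> by
  \<open>m\<close> and by \<open>n\<close> coincide, because \<open>k \<otimes> m\<close> and
  \<open>k \<otimes> n\<close> are related. By equivariance so do the shifts of
  \<open>\<tau> x\<close>, whose values at \<open>\<one>\<close> are \<open>\<tau> x m\<close> and
  \<open>\<tau> x n\<close>.\<close>

lemma cellular_automaton_periodic_configs: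
  assumes cong: "monoid_congruence G R" and \<tau>: "cellular_automaton G A \<tau>"
    and x: "x \<in> periodic_configs G A R"
  shows "\<tau> x \<in> periodic_configs G A R"
proof -
  have xc: "x \<in> configs G A"
    using x unfolding periodic_configs_def by simp
  then have \<tau>x: "\<tau> x \<in> configs G A"
    using \<tau> unfolding cellular_automaton_def by blast
  have "\<tau> x m = \<tau> x n" if mn: "(m, n) \<in> R" for m n
  proof -
    have carr: "m \<in> carrier G" "n \<in> carrier G"
      using monoid_congruenceD(4,5)[OF cong mn] .
    have "x (k \<otimes> m) = x (k \<otimes> n)" if "k \<in> carrier G" for k
      using x monoid_congruenceD(6)[OF cong monoid_congruenceD(1)[OF cong that] mn]
      unfolding periodic_configs_def by blast
    then have "shift G m x = shift G n x"
      unfolding shift_def by (simp add: fun_eq_iff restrict_def)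
    then have "shift G m (\<tau> x) = shift G n (\<tau> x)"
      using \<tau> carr xc unfolding cellular_automaton_def by metis
    then have "shift G m (\<tau> x) \<one> = shift G n (\<tau> x) \<one>"
      by simp
    with carr show ?thesis
      unfolding shift_def by simp
  qed
  with \<tau>x show ?thesis
    unfolding periodic_configs_def by blast
qed

text \<open>This gives the density of the image. As \<open>R\<close> separates the points of
  \<open>F\<close>, the values of \<open>y\<close> on \<open>F\<close> extend to a periodic
  configuration \<open>z\<close>, which has a preimage because \<open>\<tau>\<close> is an injective
  self-map of the finite set of periodic configurations.\<close>

lemma exists_preimage_agreeing_on:
  assumes cong: "monoid_congruence G R" and fin: "finite (carrier G // R)" "finite A"
    and \<tau>: "cellular_automaton G A \<tau>" and inj: "inj_on \<tau> (configs G A)"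
    and F: "F \<subseteq> carrier G" "inj_on (\<lambda>m. R `` {m}) F" and y: "y \<in> configs G A"
  shows "\<exists>x\<in>configs G A. \<forall>m\<in>F. \<tau> x m = y m"
proof -
  let ?X = "periodic_configs G A R"
  have "inj_on \<tau> ?X" "\<tau> ` ?X \<subseteq> ?X"
    using inj cellular_automaton_periodic_configs[OF cong \<tau>]
    by (auto simp: periodic_configs_def intro: inj_on_subset)
  then have onto: "\<tau> ` ?X = ?X"
    using endo_inj_surj[OF finite_periodic_configs[OF cong fin]] by blast
  \<comment> \<open>A default symbol for the classes that miss \<open>F\<close>; it exists because
    \<open>y\<close> takes a value at \<open>\<one>\<close>.\<close>
  obtain a where a: "a \<in> A"
    using y PiE_mem[OF _ one_closed] unfolding configs_def by blast
  define r where "r Q = (if \<exists>m\<in>F. R `` {m} = Q then y (inv_into F (\<lambda>m. R `` {m}) Q) else a)" for Q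
  define z where "z = (\<lambda>m\<in>carrier G. r (R `` {m}))"
  have "r Q \<in> A" for Q
  proof (cases "\<exists>m\<in>F. R `` {m} = Q")
    case True
    then have "inv_into F (\<lambda>m. R `` {m}) Q \<in> carrier G"
      using F(1) inv_into_into[of Q "\<lambda>m. R `` {m}" F] by blast
    with True y show ?thesis
      unfolding r_def configs_def by auto
  qed (simp add: r_def a)
  then have "z \<in> configs G A"
    unfolding z_def configs_def by auto
  moreover have "z m = z n" if mn: "(m, n) \<in> R" for m n
  proof -
    have "R `` {m} = R `` {n}"
      using cong mn equiv_class_eq unfolding monoid_congruence_def by metis
    then show ?thesis
      using monoid_congruenceD(4,5)[OF cong mn] unfolding z_def by simp
  qed
  ultimately have "z \<in> ?X"
    unfolding periodic_configs_def by blast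
  then have "z \<in> \<tau> ` ?X"
    using onto by simp
  then obtain x where x: "x \<in> ?X" "\<tau> x = z"
    by (elim imageE) simp
  have "\<tau> x m = y m" if m: "m \<in> F" for m
  proof -
    have "inv_into F (\<lambda>m. R `` {m}) (R `` {m}) = m"
      using inv_into_f_f[OF F(2) m] .
    with m F(1) show ?thesis
      unfolding x(2) z_def r_def by auto
  qed
  with x(1) show ?thesis
    unfolding periodic_configs_def by blast
qed

text \<open>By uniform continuity the value of \<open>\<tau> x\<close> at \<open>m\<close> depends
  only on \<open>x\<close> restricted to a finite set \<open>F\<close>. So with each point the
  complement contains the cylinder \<open>U\<close> over \<open>F\<close>, which is open in the
  product topology.\<close>

lemma closedin_preimage_coordinate:
  assumes \<tau>: "cellular_automaton G A \<tau>" and m: "m \<in> carrier G"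
  shows "closedin (product_topology (\<lambda>_. discrete_topology A) (carrier G))
    {x \<in> configs G A. \<tau> x m = v}"
proof -
  let ?T = "product_topology (\<lambda>_. discrete_topology A) (carrier G)"
  have "eventually (\<lambda>p. p \<in> agree_entourage G A {m}) (prodiscrete_uniformity G A)"
    unfolding eventually_prodiscrete_uniformity using m by (intro exI[of _ "{m}"]) auto
  then have "eventually (\<lambda>p. (case p of (x, y) \<Rightarrow> (\<tau> x, \<tau> y)) \<in> agree_entourage G A {m})
      (prodiscrete_uniformity G A)"
    using \<tau> unfolding cellular_automaton_def filterlim_iff by blast
  then obtain F where F: "finite F" "F \<subseteq> carrier G"
    and unif: "\<And>x y. (x, y) \<in> agree_entourage G A F \<Longrightarrow> (\<tau> x, \<tau> y) \<in> agree_entourage G A {m}"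
    unfolding eventually_prodiscrete_uniformity by fastforce
  have local_rule: "\<tau> x m = \<tau> y m"
    if "x \<in> configs G A" "y \<in> configs G A" "\<And>i. i \<in> F \<Longrightarrow> x i = y i" for x y
  proof -
    have "(x, y) \<in> agree_entourage G A F"
      using that unfolding agree_entourage_def by (auto simp: restrict_def fun_eq_iff)
    then have "restrict (\<tau> x) {m} = restrict (\<tau> y) {m}"
      using unif unfolding agree_entourage_def by blast
    then show ?thesis
      by (metis restrict_apply' singletonI)
  qed
  have "openin ?T {x \<in> configs G A. \<tau> x m \<noteq> v}"
  proof (subst openin_subopen, intro ballI)
    fix x assume "x \<in> {x \<in> configs G A. \<tau> x m \<noteq> v}"
    then have x: "x \<in> configs G A" "\<tau> x m \<noteq> v"
      by auto
    define U where "U = (\<Pi>\<^sub>E i\<in>carrier G. if i \<in> F then {x i} else A)"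
    have xA: "x i \<in> A" if "i \<in> carrier G" for i
      using x(1) that unfolding configs_def by blast
    have "{i \<in> carrier G. (if i \<in> F then {x i} else A) \<noteq> topspace (discrete_topology A)} \<subseteq> F"
      by (auto split: if_splits)
    then have "openin ?T U"
      unfolding U_def openin_PiE_gen using F(1) xA finite_subset by auto
    moreover have "x \<in> U"
      using x(1) unfolding U_def configs_def by (auto simp: PiE_iff)
    moreover have "U \<subseteq> {x \<in> configs G A. \<tau> x m \<noteq> v}"
    proof
      fix z assume z: "z \<in> U"
      then have zi: "z i \<in> (if i \<in> F then {x i} else A)" if "i \<in> carrier G" for i
        using that unfolding U_def by (rule PiE_mem)
      have "z i = x i" if "i \<in> F" for i
        using zi[of i] that F(2) by auto
      moreover have zc: "z \<in> configs G A"
        using z xA unfolding U_def configs_def by (auto simp: PiE_iff split: if_splits)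
      ultimately have "\<tau> z m = \<tau> x m"
        by (intro local_rule x(1))
      with x(2) zc show "z \<in> {x \<in> configs G A. \<tau> x m \<noteq> v}"
        by simp
    qed
    ultimately show "\<exists>T. openin ?T T \<and> x \<in> T \<and> T \<subseteq> {x \<in> configs G A. \<tau> x m \<noteq> v}"
      by blast
  qed
  moreover have "topspace ?T - {x \<in> configs G A. \<tau> x m = v} = {x \<in> configs G A. \<tau> x m \<noteq> v}"
    by (auto simp: configs_def)
  ultimately show ?thesis
    unfolding closedin_def by (auto simp: configs_def)
qed

text \<open>The preimages of \<open>y\<close> form the intersection of the closed sets
  \<open>C m\<close>. Finitely many of these have a common point by density of the image, so
  compactness of the product gives a point common to all.\<close>

lemma surjunctive_if_residually_finite:
  assumes "\<And>P. finite P \<Longrightarrow> (\<And>a. (a, a) \<notin> P) \<Longrightarrow>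
    \<exists>R. monoid_congruence G R \<and> finite (carrier G // R) \<and> R \<inter> P = {}"
  shows "surjunctive TYPE('d) G"
  unfolding surjunctive_def
proof (intro allI impI)
  fix A :: "'d set" and \<tau>
  assume A: "finite A" and \<tau>: "cellular_automaton G A \<tau>" and inj: "inj_on \<tau> (configs G A)"
  let ?T = "product_topology (\<lambda>_. discrete_topology A) (carrier G)"
  have maps: "\<tau> x \<in> configs G A" if "x \<in> configs G A" for x
    using \<tau> that unfolding cellular_automaton_def by blast
  have "y \<in> \<tau> ` configs G A" if y: "y \<in> configs G A" for y
  proof -
    define C where "C m = {x \<in> configs G A. \<tau> x m = y m}" for m
    have "compact_space ?T"
      using A by (simp add: compact_space_product_topology compact_space_discrete_topology)
    moreover have "closedin ?T D" if "D \<in> C ` carrier G" for D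
      using that closedin_preimage_coordinate[OF \<tau>] unfolding C_def by blast
    moreover have "\<Inter>\<F> \<noteq> {}" if \<F>: "finite \<F>" "\<F> \<subseteq> C ` carrier G" for \<F>
    proof -
      obtain F where F: "F \<subseteq> carrier G" "finite F" "\<F> = C ` F"
        using finite_subset_image[OF \<F>] by blast
      \<comment> \<open>Avoiding the off-diagonal pairs of \<open>F\<close> makes the class map
        injective on \<open>F\<close>.\<close>
      obtain R where R: "monoid_congruence G R" "finite (carrier G // R)" "R \<inter> (F \<times> F - Id) = {}"
        using assms[of "F \<times> F - Id"] F(2) by auto
      have "inj_on (\<lambda>m. R `` {m}) F"
      proof (rule inj_onI)
        fix m n assume mn: "m \<in> F" "n \<in> F" "R `` {m} = R `` {n}"
        then have "(m, n) \<in> R"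
          using monoid_congruenceD(1)[OF R(1), of n] F(1) by blast
        with mn R(3) show "m = n" by blast
      qed
      then obtain x where "x \<in> configs G A" "\<forall>m\<in>F. \<tau> x m = y m"
        using exists_preimage_agreeing_on[OF R(1,2) A \<tau> inj F(1) _ y] by blast
      then have "x \<in> \<Inter>\<F>"
        unfolding F(3) C_def by blast
      then show ?thesis by blast
    qed
    ultimately have "\<Inter>(C ` carrier G) \<noteq> {}"
      unfolding compact_space_fip by blast
    then obtain x where x: "\<And>m. m \<in> carrier G \<Longrightarrow> x \<in> C m"
      by blast
    then have xc: "x \<in> configs G A"
      using one_closed unfolding C_def by blast
    have "\<tau> x = y"
      using maps[OF xc] y x unfolding configs_def C_def by (intro PiE_ext) auto
    with xc show ?thesis by blast
  qed
  with maps show "\<tau> ` configs G A = configs G A"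
    by blast
qed

end

theorem corollary5p18:
  fixes M :: "('a, 'c) monoid_scheme"
  assumes "comm_monoid M"
    and "finitely_generated_monoid M"
  shows "surjunctive TYPE('b) M"
proof -
  interpret comm_monoid M by fact
  show ?thesis
    by (rule surjunctive_if_residually_finite)
      (rule finite_index_congruence_avoiding_pairs[OF assms(2)])
qed

end
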